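(* Let $(A,\dashv,\vdash,\alpha,\beta)$ be a BiHom-associative dialgebra and let $s,r,s',r'$ be non-negative integers. For any $\mathcal D\in Der_{(\alpha^s,\beta^r)}(A)$ and $\mathcal D'\in Der_{(\alpha^{s'},\beta^{r'})}(A)$, the commutator $[\mathcal D,\mathcal D']=\mathcal D\circ\mathcal D'-\mathcal D'\circ\mathcal D$ belongs to $Der_{(\alpha^{s+s'},\beta^{r+r'})}(A)$.
   Context: All vector spaces are over a fixed field. A BiHom-associative dialgebra is a tuple $(A,\dashv,\vdash,\alpha,\beta)$ consisting of a vector space $A$, bilinear maps $\dashv,\vdash:A\times A\to A$ and linear maps $\alpha,\beta:A\to A$ such that $\alpha\circ\beta=\beta\circ\alpha$ and, for all $x,y,z\in A$: (i) $(x\dashv y)\dashv\beta(z)=\alpha(x)\dashv(y\dashv z)$; (ii) $(x\dashv y)\dashv\beta(z)=\alpha(x)\dashv(y\vdash z)$; (iii) $(x\vdash y)\dashv\beta(z)=\alpha(x)\vdash(y\dashv z)$; (iv) $(x\dashv y)\vdash\beta(z)=\alpha(x)\vdash(y\vdash z)$; (v) $(x\vdash y)\vdash\beta(z)=\alpha(x)\vdash(y\vdash z)$. $Der_{(\alpha^k,\beta^l)}(A)$ is the set of $(\alpha^k,\beta^l)$-derivations of $A$: linear maps $\mathcal D:A\to A$ with $\mathcal D\circ\alpha=\alpha\circ\mathcal D$, $\mathcal D\circ\beta=\beta\circ\mathcal D$, $\mathcal D(x\dashv y)=\alpha^k\beta^l(x)\dashv\mathcal D(y)+\mathcal D(x)\dashv\alpha^k\beta^l(y)$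 and $\mathcal D(x\vdash y)=\alpha^k\beta^l(x)\vdash\mathcal D(y)+\mathcal D(x)\vdash\alpha^k\beta^l(y)$ for all $x,y\in A$. *)

theory Defs
  imports Main "HOL.Vector_Spaces"
begin

definition bilinear_op :: "('k::field \<Rightarrow> 'a::ab_group_add \<Rightarrow> 'a) \<Rightarrow> ('a \<Rightarrow> 'a \<Rightarrow> 'a) \<Rightarrow> bool"
  where "bilinear_op scale f \<longleftrightarrow>
    (\<forall>x. Vector_Spaces.linear scale scale (\<lambda>y. f x y)) \<and>
    (\<forall>y. Vector_Spaces.linear scale scale (\<lambda>x. f x y))"

text \<open>The twisting maps are not assumed to be multiplicative for the two products.\<close>

locale bihom_assoc_dialgebra = vector_space scale
  for scale :: "'k::field \<Rightarrow> 'a::ab_group_add \<Rightarrow> 'a" +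
  fixes lprod :: "'a \<Rightarrow> 'a \<Rightarrow> 'a" (infixl \<open>\<stileturn>\<close> 70)
    and rprod :: "'a \<Rightarrow> 'a \<Rightarrow> 'a" (infixl \<open>\<turnstile>\<close> 70)
    and \<alpha> :: "'a \<Rightarrow> 'a"
    and \<beta> :: "'a \<Rightarrow> 'a"
  assumes bilinear_lprod: "bilinear_op scale (\<stileturn>)"
    and bilinear_rprod: "bilinear_op scale (\<turnstile>)"
    and linear_\<alpha>: "Vector_Spaces.linear scale scale \<alpha>"
    and linear_\<beta>: "Vector_Spaces.linear scale scale \<beta>"
    and twist_commute: "\<alpha> \<circ> \<beta> = \<beta> \<circ> \<alpha>"
    and assoc_ll: "(x \<stileturn> y) \<stileturn> \<beta> z = \<alpha> x \<stileturn> (y \<stileturn> z)"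
    and assoc_ll_lr: "(x \<stileturn> y) \<stileturn> \<beta> z = \<alpha> x \<stileturn> (y \<turnstile> z)"
    and assoc_rl: "(x \<turnstile> y) \<stileturn> \<beta> z = \<alpha> x \<turnstile> (y \<stileturn> z)"
    and assoc_lr_rr: "(x \<stileturn> y) \<turnstile> \<beta> z = \<alpha> x \<turnstile> (y \<turnstile> z)"
    and assoc_rr: "(x \<turnstile> y) \<turnstile> \<beta> z = \<alpha> x \<turnstile> (y \<turnstile> z)"
begin

definition Der :: "nat \<Rightarrow> nat \<Rightarrow> ('a \<Rightarrow> 'a) set"
  where "Der k l = {D. Vector_Spaces.linear scale scale D \<and>
    D \<circ> \<alpha> = \<alpha> \<circ> D \<and> D \<circ> \<beta> = \<beta> \<circ> D \<and>
    (\<forall>x y. D (x \<stileturn> y) =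
      (\<alpha> ^^ k) ((\<beta> ^^ l) x) \<stileturn> D y + D x \<stileturn> (\<alpha> ^^ k) ((\<beta> ^^ l) y)) \<and>
    (\<forall>x y. D (x \<turnstile> y) =
      (\<alpha> ^^ k) ((\<beta> ^^ l) x) \<turnstile> D y + D x \<turnstile> (\<alpha> ^^ k) ((\<beta> ^^ l) y))}"

end

text \<open>The commutator of maps on \<open>A\<close>; the difference is the pointwise one.\<close>

definition commutator :: "('a::ab_group_add \<Rightarrow> 'a) \<Rightarrow> ('a \<Rightarrow> 'a) \<Rightarrow> 'a \<Rightarrow> 'a"
  where "commutator D D' = (D \<circ> D') - (D' \<circ> D)"

end

theory Submission
  imports Defs
begin

text \<open>
  Write \<open>T = \<alpha>^s \<beta>^r\<close> and \<open>T' = \<alpha>^s' \<beta>^r'\<close> for the twists of the two derivations.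
  Applying the Leibniz rules of \<open>D'\<close> and then \<open>D\<close> to a product gives
  \<open>D (D' (x y)) = (T T' x) (D D' y) + (D T' x) (T D' y) + (T D' x) (D T' y) + (D D' x) (T T' y)\<close>.
  Each of \<open>D\<close>, \<open>D'\<close> commutes with \<open>\<alpha>\<close> and \<open>\<beta>\<close>, hence with both twists, and the twists commute
  with each other. The sum of the two
  middle terms is therefore symmetric in the two derivations and cancels in the commutator, and
  what is left is its Leibniz rule with twist \<open>T T' = \<alpha>^(s + s') \<beta>^(r + r')\<close>. The cancellation,
  \<open>commutator_twisted_leibniz\<close>, concerns a single biadditive product, so it serves for both
  products of the dialgebra.
\<close>

lemma funpow_comp_commute:
  assumes "f \<circ> g = g \<circ> f"
  shows "f ((g ^^ n) x) = (g ^^ n) (f x)"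
  using assms by (induction n) (simp_all add: fun_eq_iff)

lemma twist_compose:
  assumes "a \<circ> b = b \<circ> a"
  shows "(a ^^ s) ((b ^^ r) ((a ^^ s') ((b ^^ r') x))) = (a ^^ (s + s')) ((b ^^ (r + r')) x)"
proof -
  have "a ((b ^^ r) y) = (b ^^ r) (a y)" for y
    using assms by (rule funpow_comp_commute)
  hence "(b ^^ r) \<circ> a = a \<circ> (b ^^ r)"
    by (simp add: fun_eq_iff)
  hence "(b ^^ r) ((a ^^ s') y) = (a ^^ s') ((b ^^ r) y)" for y
    by (rule funpow_comp_commute)
  thus ?thesis
    by (simp add: funpow_add)
qed

lemma commutator_apply: "commutator D D' x = D (D' x) - D' (D x)"
  by (simp add: commutator_def)

lemma commutator_comp_commute:
  assumes "D \<circ> f = f \<circ> D" and "D' \<circ> f = f \<circ> D'"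
    and "\<And>x y. f (x - y) = f x - f y"
  shows "commutator D D' \<circ> f = f \<circ> commutator D D'"
  using assms by (simp add: fun_eq_iff commutator_apply)

lemma commutator_twisted_leibniz:
  fixes f :: "'a::ab_group_add \<Rightarrow> 'a \<Rightarrow> 'a"
  assumes diff_left: "\<And>x y z. f (x - y) z = f x z - f y z"
    and diff_right: "\<And>x y z. f x (y - z) = f x y - f x z"
    and add: "\<And>x y. D (x + y) = D x + D y" "\<And>x y. D' (x + y) = D' x + D' y"
    and leibniz: "\<And>x y. D (f x y) = f (T x) (D y) + f (D x) (T y)"
    and leibniz': "\<And>x y. D' (f x y) = f (T' x) (D' y) + f (D' x) (T' y)"
    and comm: "\<And>x. D (T' x) = T' (D x)" "\<And>x. D' (T x) = T (D' x)" "\<And>x. T' (T x) = T (T' x)"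
  shows "commutator D D' (f x y) =
    f (T (T' x)) (commutator D D' y) + f (commutator D D' x) (T (T' y))"
  unfolding commutator_apply
  by (simp add: leibniz leibniz' add comm diff_left diff_right)

context bihom_assoc_dialgebra
begin

lemma Der_comm_twist:
  assumes "D \<in> Der k l"
  shows "D ((\<alpha> ^^ m) ((\<beta> ^^ n) x)) = (\<alpha> ^^ m) ((\<beta> ^^ n) (D x))"
  using assms by (simp add: Der_def funpow_comp_commute)

lemma commutator_in_Der:
  assumes D: "D \<in> Der s r" and D': "D' \<in> Der s' r'"
  shows "commutator D D' \<in> Der (s + s') (r + r')"
proof -
  interpret pair: vector_space_pair scale scale ..
  let ?T = "\<lambda>x. (\<alpha> ^^ s) ((\<beta> ^^ r) x)" and ?T' = "\<lambda>x. (\<alpha> ^^ s') ((\<beta> ^^ r') x)"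
  have lin: "Vector_Spaces.linear scale scale D" "Vector_Spaces.linear scale scale D'"
    using D D' by (simp_all add: Der_def)
  have "Vector_Spaces.linear scale scale (\<lambda>x. D (D' x) - D' (D x))"
    using Vector_Spaces.linear_compose[OF lin(2,1)] Vector_Spaces.linear_compose[OF lin]
    by (simp add: pair.linear_compose_sub o_def)
  hence linear: "Vector_Spaces.linear scale scale (commutator D D')"
    by (simp add: commutator_apply[abs_def])
  have twist: "?T (?T' x) = (\<alpha> ^^ (s + s')) ((\<beta> ^^ (r + r')) x)" for x
    by (rule twist_compose[OF twist_commute])
  have twist_swap: "?T' (?T x) = ?T (?T' x)" for x
    by (simp add: twist_compose[OF twist_commute] add.commute)
  have leibniz: "commutator D D' (f x y) =
      f ((\<alpha> ^^ (s + s')) ((\<beta> ^^ (r + r')) x)) (commutator D D' y) +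
      f (commutator D D' x) ((\<alpha> ^^ (s + s')) ((\<beta> ^^ (r + r')) y))"
    if f: "bilinear_op scale f"
      and "\<And>x y. D (f x y) = f (?T x) (D y) + f (D x) (?T y)"
      and "\<And>x y. D' (f x y) = f (?T' x) (D' y) + f (D' x) (?T' y)"
    for f x y
  proof -
    have "f (x - y) z = f x z - f y z" "f x (y - z) = f x y - f x z" for x y z
      using f pair.linear_diff[of "\<lambda>x. f x z"] pair.linear_diff[of "f x"]
      by (auto simp: bilinear_op_def)
    from commutator_twisted_leibniz[where f = f and T = ?T and T' = ?T', OF this
        pair.linear_add[OF lin(1)] pair.linear_add[OF lin(2)] that(2,3)
        Der_comm_twist[OF D] Der_comm_twist[OF D'] twist_swap]
    show ?thesis
      by (simp only: twist)
  qed
  show ?thesis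
    using D D' linear leibniz[OF bilinear_lprod] leibniz[OF bilinear_rprod]
      commutator_comp_commute[of D _ D', OF _ _ pair.linear_diff[OF linear_\<alpha>]]
      commutator_comp_commute[of D _ D', OF _ _ pair.linear_diff[OF linear_\<beta>]]
    unfolding Der_def by blast
qed

end

theorem proposition5p4:
  fixes scale :: "'k::field \<Rightarrow> 'a::ab_group_add \<Rightarrow> 'a"
    and lprod rprod :: "'a \<Rightarrow> 'a \<Rightarrow> 'a"
    and \<alpha> \<beta> D D' :: "'a \<Rightarrow> 'a"
    and s r s' r' :: nat
  assumes "bihom_assoc_dialgebra scale lprod rprod \<alpha> \<beta>"
    and "D \<in> bihom_assoc_dialgebra.Der scale lprod rprod \<alpha> \<beta> s r"
    and "D' \<in> bihom_assoc_dialgebra.Der scale lprod rprod \<alpha> \<beta> s' r'"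
  shows "commutator D D' \<in> bihom_assoc_dialgebra.Der scale lprod rprod \<alpha> \<beta> (s + s') (r + r')"
  using assms by (rule bihom_assoc_dialgebra.commutator_in_Der)

end
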